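(* Let $\mathcal R=(R,\oplus,\le,0)$ be a distance magma and $S\subseteq R$ with $0\in S$. Then $\mathcal S^*=(S^*,\oplus^*,\le^*,0)$ is a distance magma.
   Context: A distance magma is a structure $(R,\oplus,\le,0)$ with $\oplus$ binary, $0\in R$, such that $\le$ is a total order, $r\le r\oplus s$, $r\le t,s\le u\Rightarrow r\oplus s\le t\oplus u$, $\oplus$ is commutative, and $r\oplus0=r=0\oplus r$. $\mathcal L_S$ is the relational language with a binary relation symbol $d(x,y)\le s$ for each $s\in S$; $d(x,y)>s$ denotes its negation. $T_{\mathrm{MS}}(S,\mathcal R)$ is the $\mathcal L_S$-theory consisting of: (MS1) $\forall x\forall y(d(x,y)\le 0\leftrightarrow x=y)$; (MS2) for $s\in S$, $\forall x\forall y(d(x,y)\le s\leftrightarrow d(y,x)\le s)$; (MS3) for $r,s,t\in S$ such that no $x\in S$ satisfies $t<x\le r\oplus s$, $\forall x\forall y\forall z((d(x,y)\le r\wedge d(y,z)\le s)\to d(x,z)\le t)$; (MS4) if $S$ has a maximum $s$, $\forall x\forall y\,d(x,y)\le s$. A cut in $S$ is an upward-closed subset $X\subseteq S$ that contains the maximum of $S$ if $S$ has one. $S^*$ is the set of cuts in $S$, ordered by $X\le^* Y$ iff $Y\subseteq X$; $r\in S$ is identified with the cut $\{x\in S:x\ge r\}$, so $0\in S^*$. For $\alpha\in S^*$, $p_\alpha(x,y)=\{d(x,y)\le s:s\in S,\alpha\le^* s\}\cup\{d(x,y)>s:s\in S,s<^*\alpha\}$. A triple $(\alpha,\beta,\gamma)\in(S^*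 )^3$ is a logical $S^*$-triangle if $T_{\mathrm{MS}}(S,\mathcal R)\cup p_\alpha(x,y)\cup p_\beta(y,z)\cup p_\gamma(x,z)$ is consistent; $\Sigma(\alpha,\beta)$ is the set of $\gamma$ making $(\alpha,\beta,\gamma)$ a logical $S^*$-triangle, and $\alpha\oplus^*\beta=\sup\Sigma(\alpha,\beta)$ (supremum in the complete linear order $(S^*,\le^* )$). *)

theory Defs
  imports Main
begin

text \<open>The carrier is a subset of the ambient type; \<open>le\<close> and \<open>oplus\<close> are only constrained on it.\<close>

locale distance_magma =
  fixes R :: "'a set"
    and oplus :: "'a \<Rightarrow> 'a \<Rightarrow> 'a"
    and le :: "'a \<Rightarrow> 'a \<Rightarrow> bool"
    and zero :: 'a
  assumes plus_closed: "\<lbrakk>r \<in> R; s \<in> R\<rbrakk> \<Longrightarrow> oplus r s \<in> R"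
    and zero_closed: "zero \<in> R"
    and total_order: "linear_order_on R {(x, y). x \<in> R \<and> y \<in> R \<and> le x y}"
    and le_plus: "\<lbrakk>r \<in> R; s \<in> R\<rbrakk> \<Longrightarrow> le r (oplus r s)"
    and plus_mono: "\<lbrakk>r \<in> R; s \<in> R; t \<in> R; u \<in> R; le r t; le s u\<rbrakk>
          \<Longrightarrow> le (oplus r s) (oplus t u)"
    and plus_commute: "\<lbrakk>r \<in> R; s \<in> R\<rbrakk> \<Longrightarrow> oplus r s = oplus s r"
    and plus_zero_right: "r \<in> R \<Longrightarrow> oplus r zero = r"
    and plus_zero_left: "r \<in> R \<Longrightarrow> oplus zero r = r"

definition lt_of :: "('b \<Rightarrow> 'b \<Rightarrow> bool) \<Rightarrow> 'b \<Rightarrow> 'b \<Rightarrow> bool" where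
  "lt_of le x y \<longleftrightarrow> le x y \<and> x \<noteq> y"

definition is_max :: "'a set \<Rightarrow> ('a \<Rightarrow> 'a \<Rightarrow> bool) \<Rightarrow> 'a \<Rightarrow> bool" where
  "is_max S le m \<longleftrightarrow> m \<in> S \<and> (\<forall>x\<in>S. le x m)"

text \<open>\<open>DistLe s i j\<close> is the atomic formula \<open>d(x_i, x_j) \<le> s\<close>: one binary relation symbol for
  each \<open>s\<close>. Variables are named by natural numbers.\<close>

datatype 's fm =
    DistLe 's nat nat
  | Equal nat nat
  | Neg "'s fm"
  | Conj "'s fm" "'s fm"
  | Imp "'s fm" "'s fm"
  | All nat "'s fm"

abbreviation DistGt :: "'s \<Rightarrow> nat \<Rightarrow> nat \<Rightarrow> 's fm" where
  "DistGt s i j \<equiv> Neg (DistLe s i j)"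

abbreviation Iff :: "'s fm \<Rightarrow> 's fm \<Rightarrow> 's fm" where
  "Iff p q \<equiv> Conj (Imp p q) (Imp q p)"

text \<open>Tarskian satisfaction in the structure with universe \<open>M\<close>, where the symbol indexed by \<open>s\<close>
  is interpreted by the binary relation \<open>I s\<close>.\<close>

primrec sat :: "'m set \<Rightarrow> ('s \<Rightarrow> 'm \<Rightarrow> 'm \<Rightarrow> bool) \<Rightarrow> (nat \<Rightarrow> 'm) \<Rightarrow> 's fm \<Rightarrow> bool" where
  "sat M I v (DistLe s i j) \<longleftrightarrow> I s (v i) (v j)"
| "sat M I v (Equal i j) \<longleftrightarrow> v i = v j"
| "sat M I v (Neg p) \<longleftrightarrow> \<not> sat M I v p"
| "sat M I v (Conj p q) \<longleftrightarrow> sat M I v p \<and> sat M I v q"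
| "sat M I v (Imp p q) \<longleftrightarrow> (sat M I v p \<longrightarrow> sat M I v q)"
| "sat M I v (All i p) \<longleftrightarrow> (\<forall>a\<in>M. sat M I (v(i := a)) p)"

text \<open>A set of formulas, possibly with free variables, is consistent if it is realised in some
  nonempty structure. HOL cannot quantify existentially over types, so the universe is taken to
  be an arbitrary nonempty subset of \<open>'s + nat\<close>. This is no restriction: the language has at
  most as many symbols as \<open>'s\<close> has elements, so by the downward Loewenheim-Skolem theorem a
  set of formulas realised in any structure is realised in one of cardinality at most that of
  \<open>'s + nat\<close>.\<close>

definition consistent :: "'s fm set \<Rightarrow> bool" where
  "consistent \<Gamma> \<longleftrightarrow>
     (\<exists>(M :: ('s + nat) set) I v. M \<noteq> {} \<and> range v \<subseteq> M \<and> (\<forall>\<phi>\<in>\<Gamma>. sat M I v \<phi>))"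

definition T_MS ::
  "'a set \<Rightarrow> ('a \<Rightarrow> 'a \<Rightarrow> 'a) \<Rightarrow> ('a \<Rightarrow> 'a \<Rightarrow> bool) \<Rightarrow> 'a \<Rightarrow> 'a fm set" where
  "T_MS S oplus le zero =
     {All 0 (All 1 (Iff (DistLe zero 0 1) (Equal 0 1)))}
   \<union> {All 0 (All 1 (Iff (DistLe s 0 1) (DistLe s 1 0))) | s. s \<in> S}
   \<union> {All 0 (All 1 (All 2 (Imp (Conj (DistLe r 0 1) (DistLe s 1 2)) (DistLe t 0 2)))) | r s t.
        r \<in> S \<and> s \<in> S \<and> t \<in> S \<and> \<not> (\<exists>x\<in>S. lt_of le t x \<and> le x (oplus r s))}
   \<union> {All 0 (All 1 (DistLe s 0 1)) | s. is_max S le s}"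

definition cuts :: "'a set \<Rightarrow> ('a \<Rightarrow> 'a \<Rightarrow> bool) \<Rightarrow> 'a set set" where
  "cuts S le = {X. X \<subseteq> S \<and> (\<forall>x\<in>X. \<forall>y\<in>S. le x y \<longrightarrow> y \<in> X) \<and> (\<forall>m. is_max S le m \<longrightarrow> m \<in> X)}"

definition cut_le :: "'a set \<Rightarrow> 'a set \<Rightarrow> bool" where
  "cut_le X Y \<longleftrightarrow> Y \<subseteq> X"

definition cut_of :: "'a set \<Rightarrow> ('a \<Rightarrow> 'a \<Rightarrow> bool) \<Rightarrow> 'a \<Rightarrow> 'a set" where
  "cut_of S le r = {x \<in> S. le r x}"

definition cut_sup :: "'a set \<Rightarrow> ('a \<Rightarrow> 'a \<Rightarrow> bool) \<Rightarrow> 'a set set \<Rightarrow> 'a set" where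
  "cut_sup S le A =
     (THE \<gamma>. \<gamma> \<in> cuts S le \<and> (\<forall>\<alpha>\<in>A. cut_le \<alpha> \<gamma>) \<and>
        (\<forall>\<delta>\<in>cuts S le. (\<forall>\<alpha>\<in>A. cut_le \<alpha> \<delta>) \<longrightarrow> cut_le \<gamma> \<delta>))"

definition cut_type ::
  "'a set \<Rightarrow> ('a \<Rightarrow> 'a \<Rightarrow> bool) \<Rightarrow> 'a set \<Rightarrow> nat \<Rightarrow> nat \<Rightarrow> 'a fm set" where
  "cut_type S le \<alpha> i j =
     {DistLe s i j | s. s \<in> S \<and> cut_le \<alpha> (cut_of S le s)}
   \<union> {DistGt s i j | s. s \<in> S \<and> lt_of cut_le (cut_of S le s) \<alpha>}"

text \<open>The free variables \<open>x, y, z\<close> are the variables 0, 1, 2.\<close>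

definition logical_triangle ::
  "'a set \<Rightarrow> ('a \<Rightarrow> 'a \<Rightarrow> 'a) \<Rightarrow> ('a \<Rightarrow> 'a \<Rightarrow> bool) \<Rightarrow> 'a
     \<Rightarrow> 'a set \<Rightarrow> 'a set \<Rightarrow> 'a set \<Rightarrow> bool" where
  "logical_triangle S oplus le zero \<alpha> \<beta> \<gamma> \<longleftrightarrow>
     \<alpha> \<in> cuts S le \<and> \<beta> \<in> cuts S le \<and> \<gamma> \<in> cuts S le \<and>
     consistent (T_MS S oplus le zero \<union> cut_type S le \<alpha> 0 1 \<union> cut_type S le \<beta> 1 2
       \<union> cut_type S le \<gamma> 0 2)"

definition cut_plus ::
  "'a set \<Rightarrow> ('a \<Rightarrow> 'a \<Rightarrow> 'a) \<Rightarrow> ('a \<Rightarrow> 'a \<Rightarrow> bool) \<Rightarrow> 'a \<Rightarrow> 'a set \<Rightarrow> 'a set \<Rightarrow> 'a set" where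
  "cut_plus S oplus le zero \<alpha> \<beta> = cut_sup S le {\<gamma>. logical_triangle S oplus le zero \<alpha> \<beta> \<gamma>}"

end

theory Submission
  imports Defs
begin

text \<open>
  The type \<open>p_\<alpha>(x, y)\<close> says that \<open>{s. d(x, y) \<le> s}\<close> is exactly \<open>\<alpha>\<close>. Since \<open>T_MS\<close> is universal, a
  triple of cuts is therefore a logical triangle iff the three-point structure that it describes
  satisfies (MS3), a purely combinatorial condition on the three cuts. If \<open>(\<alpha>, \<beta>, \<gamma>)\<close> satisfies it
  and \<open>\<alpha> \<le> \<alpha>'\<close>, \<open>\<beta> \<le> \<beta>'\<close>, then so does \<open>(\<alpha>', \<beta>', max \<gamma> \<alpha>' \<beta>')\<close>; this gives monotonicity of the sum.
  In the same way \<open>(\<alpha>, \<beta>, max \<alpha> \<beta>)\<close> gives \<open>\<alpha> \<le> \<alpha> \<oplus> \<beta>\<close>, and \<open>(\<alpha>, 0, \<gamma>)\<close> forces \<open>\<gamma> = \<alpha>\<close>.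
  As the order on cuts is reverse inclusion, maxima and suprema of cuts are intersections.
\<close>

locale distance_submagma = distance_magma R oplus le zero
  for R :: "'a set" and oplus :: "'a \<Rightarrow> 'a \<Rightarrow> 'a" and le :: "'a \<Rightarrow> 'a \<Rightarrow> bool" and zero :: 'a +
  fixes S :: "'a set"
  assumes S_subset: "S \<subseteq> R"
    and zero_in_S: "zero \<in> S"
begin

section \<open>First consequences of the magma axioms\<close>

lemma S_in_R: "x \<in> S \<Longrightarrow> x \<in> R"
  using S_subset by blast

lemma le_refl: "x \<in> R \<Longrightarrow> le x x"
  using total_order by (auto simp: order_on_defs refl_on_def)

lemma le_antisym: "\<lbrakk>x \<in> R; y \<in> R; le x y; le y x\<rbrakk> \<Longrightarrow> x = y"
  using total_order unfolding order_on_defs antisym_def by blast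

lemma le_total:
  assumes "x \<in> R" "y \<in> R"
  shows "le x y \<or> le y x"
proof (cases "x = y")
  case True
  then show ?thesis using assms le_refl by blast
next
  case False
  then show ?thesis using total_order assms unfolding order_on_defs total_on_def by blast
qed

lemma zero_le: "x \<in> R \<Longrightarrow> le zero x"
  using le_plus[of zero x] zero_closed plus_zero_left by auto

lemma cut_of_zero: "cut_of S le zero = S"
  unfolding cut_of_def using zero_le S_in_R by blast

section \<open>Cuts as a complete linear order under reverse inclusion\<close>

lemma cutsD:
  assumes "\<alpha> \<in> cuts S le"
  shows cut_subset: "\<alpha> \<subseteq> S"
    and cut_upward: "\<lbrakk>x \<in> \<alpha>; y \<in> S; le x y\<rbrakk> \<Longrightarrow> y \<in> \<alpha>"
    and cut_max: "is_max S le m \<Longrightarrow> m \<in> \<alpha>"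
  using assms unfolding cuts_def by blast+

lemma S_in_cuts: "S \<in> cuts S le"
  unfolding cuts_def is_max_def by blast

lemma cuts_Int: "\<lbrakk>\<alpha> \<in> cuts S le; \<beta> \<in> cuts S le\<rbrakk> \<Longrightarrow> \<alpha> \<inter> \<beta> \<in> cuts S le"
  unfolding cuts_def by blast

text \<open>Intersecting with \<open>S\<close> handles the empty family: its supremum is the least
  cut \<open>S\<close>, whereas \<open>\<Inter>{}\<close> would be the whole type.\<close>

lemma cuts_Inter: "A \<subseteq> cuts S le \<Longrightarrow> S \<inter> \<Inter>A \<in> cuts S le"
  unfolding cuts_def is_max_def by blast

lemma cut_eq_S: "\<lbrakk>\<alpha> \<in> cuts S le; zero \<in> \<alpha>\<rbrakk> \<Longrightarrow> \<alpha> = S"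
  using cut_subset cut_upward zero_le S_in_R by blast

text \<open>If \<open>x\<close> lies only in \<alpha> and \<open>y\<close> only in \<beta>, then
  whichever of the two is the larger must lie in both cuts by upward closure.\<close>

lemma cuts_comparable:
  assumes "\<alpha> \<in> cuts S le" "\<beta> \<in> cuts S le"
  shows "\<alpha> \<subseteq> \<beta> \<or> \<beta> \<subseteq> \<alpha>"
proof (rule ccontr)
  assume "\<not> ?thesis"
  then obtain x y where "x \<in> \<alpha>" "x \<notin> \<beta>" "y \<in> \<beta>" "y \<notin> \<alpha>" by blast
  then show False
    using cutsD[OF assms(1)] cutsD[OF assms(2)] le_total[of x y] S_in_R by blast
qed

lemma cuts_linear_order:
  "linear_order_on (cuts S le) {(x, y). x \<in> cuts S le \<and> y \<in> cuts S le \<and> cut_le x y}"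
  using cuts_comparable
  unfolding order_on_defs refl_on_def trans_def antisym_def total_on_def cut_le_def
  by auto

text \<open>Upper bounds of \<open>A\<close> are the cuts contained in every member, so the
  intersection is the least one; antisymmetry of inclusion makes it unique.\<close>

lemma cut_sup_eq:
  assumes "A \<subseteq> cuts S le"
  shows "cut_sup S le A = S \<inter> \<Inter>A"
  unfolding cut_sup_def
proof (rule the_equality)
  show "S \<inter> \<Inter>A \<in> cuts S le \<and> (\<forall>\<alpha>\<in>A. cut_le \<alpha> (S \<inter> \<Inter>A)) \<and>
    (\<forall>\<delta>\<in>cuts S le. (\<forall>\<alpha>\<in>A. cut_le \<alpha> \<delta>) \<longrightarrow> cut_le (S \<inter> \<Inter>A) \<delta>)"
    using cuts_Inter[OF assms] cut_subset unfolding cut_le_def by blast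
next
  fix \<gamma>
  assume \<gamma>: "\<gamma> \<in> cuts S le \<and> (\<forall>\<alpha>\<in>A. cut_le \<alpha> \<gamma>) \<and>
    (\<forall>\<delta>\<in>cuts S le. (\<forall>\<alpha>\<in>A. cut_le \<alpha> \<delta>) \<longrightarrow> cut_le \<gamma> \<delta>)"
  have "\<forall>\<alpha>\<in>A. cut_le \<alpha> (S \<inter> \<Inter>A)"
    unfolding cut_le_def by blast
  then have "cut_le \<gamma> (S \<inter> \<Inter>A)"
    using \<gamma> cuts_Inter[OF assms] by simp
  moreover have "\<gamma> \<subseteq> S \<inter> \<Inter>A"
    using \<gamma> cut_subset unfolding cut_le_def by blast
  ultimately show "\<gamma> = S \<inter> \<Inter>A"
    unfolding cut_le_def by blast
qed

section \<open>Triangles of cuts\<close>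

text \<open>These are the indices \<open>t\<close> for which (MS3) has an instance with premises
  \<open>d(x, y) \<le> r\<close> and \<open>d(y, z) \<le> s\<close>.\<close>

definition bounds :: "'a \<Rightarrow> 'a \<Rightarrow> 'a set" where
  "bounds r s = {t \<in> S. \<not> (\<exists>x\<in>S. lt_of le t x \<and> le x (oplus r s))}"

lemma bounds_commute: "\<lbrakk>r \<in> S; s \<in> S\<rbrakk> \<Longrightarrow> bounds r s = bounds s r"
  unfolding bounds_def using plus_commute S_in_R by simp

text \<open>If \<open>t\<close> were below \<open>r\<close>, then \<open>r\<close> itself would be
  an element of \<open>S\<close> above \<open>t\<close> and at most
  \<open>oplus r s\<close>.\<close>

lemma bounds_ge:
  assumes "r \<in> S" "s \<in> S" "t \<in> bounds r s"
  shows "le r t"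
proof (rule ccontr)
  assume "\<not> le r t"
  moreover have "t \<in> S" using assms(3) unfolding bounds_def by blast
  ultimately have "lt_of le t r"
    using le_total le_refl S_in_R assms(1) unfolding lt_of_def by blast
  then show False
    using le_plus assms S_in_R unfolding bounds_def by blast
qed

lemma bounds_subset_left:
  assumes "\<alpha> \<in> cuts S le" "r \<in> \<alpha>" "s \<in> S"
  shows "bounds r s \<subseteq> \<alpha>"
proof
  fix t assume t: "t \<in> bounds r s"
  then have "t \<in> S" unfolding bounds_def by blast
  then show "t \<in> \<alpha>" using t bounds_ge cutsD[OF assms(1)] assms by blast
qed

lemma bounds_subset_right:
  "\<lbrakk>\<alpha> \<in> cuts S le; s \<in> \<alpha>; r \<in> S\<rbrakk> \<Longrightarrow> bounds r s \<subseteq> \<alpha>"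
  using bounds_subset_left bounds_commute cut_subset by blast

text \<open>Nothing lies strictly above \<open>s\<close> and at most
  \<open>oplus zero s = s\<close>. Hence (MS3) transfers every bound between points at distance
  \<open>zero\<close>.\<close>

lemma in_bounds_zero: "s \<in> S \<Longrightarrow> s \<in> bounds zero s"
  unfolding bounds_def lt_of_def using plus_zero_left le_antisym S_in_R by auto

text \<open>This is (MS3) for three points \<open>x, y, z\<close> whose valid bounds on
  \<open>d(x, y)\<close>, \<open>d(y, z)\<close>, \<open>d(x, z)\<close> form \<alpha>, \<beta>,
  \<gamma>.\<close>

definition subadditive :: "'a set \<Rightarrow> 'a set \<Rightarrow> 'a set \<Rightarrow> bool" where
  "subadditive \<alpha> \<beta> \<gamma> \<longleftrightarrow> (\<forall>r\<in>\<alpha>. \<forall>s\<in>\<beta>. bounds r s \<subseteq> \<gamma>)"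

text \<open>One condition for each side as the bounded one; the conditions with the summands swapped
  follow by commutativity.\<close>

definition triangle :: "'a set \<Rightarrow> 'a set \<Rightarrow> 'a set \<Rightarrow> bool" where
  "triangle \<alpha> \<beta> \<gamma> \<longleftrightarrow> \<alpha> \<in> cuts S le \<and> \<beta> \<in> cuts S le \<and> \<gamma> \<in> cuts S le \<and>
     subadditive \<alpha> \<beta> \<gamma> \<and> subadditive \<alpha> \<gamma> \<beta> \<and> subadditive \<beta> \<gamma> \<alpha>"

lemma subadditive_commute:
  assumes "\<alpha> \<in> cuts S le" "\<beta> \<in> cuts S le"
  shows "subadditive \<alpha> \<beta> \<gamma> \<longleftrightarrow> subadditive \<beta> \<alpha> \<gamma>"
  using bounds_commute cut_subset[OF assms(1)] cut_subset[OF assms(2)]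
  unfolding subadditive_def by blast

lemma triangle_commute: "triangle \<alpha> \<beta> \<gamma> \<Longrightarrow> triangle \<beta> \<alpha> \<gamma>"
  unfolding triangle_def using subadditive_commute by blast

text \<open>Here \<gamma> is at most \<alpha> in the order on cuts, and a side at most one summand
  satisfies (MS3): every member of \<open>bounds r s\<close> dominates \<open>r\<close>.\<close>

lemma subadditive_left:
  "\<lbrakk>\<gamma> \<in> cuts S le; \<alpha> \<subseteq> \<gamma>; \<beta> \<subseteq> S\<rbrakk> \<Longrightarrow> subadditive \<alpha> \<beta> \<gamma>"
  unfolding subadditive_def by (meson bounds_subset_left subsetD)

lemma subadditive_right:
  "\<lbrakk>\<gamma> \<in> cuts S le; \<alpha> \<subseteq> S; \<beta> \<subseteq> \<gamma>\<rbrakk> \<Longrightarrow> subadditive \<alpha> \<beta> \<gamma>"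
  unfolding subadditive_def by (meson bounds_subset_right subsetD)

text \<open>As in an ultrametric triangle, each side is at most the maximum of the other two, so
  (MS3) holds in every direction.\<close>

lemma triangle_max:
  assumes "\<alpha> \<in> cuts S le" "\<beta> \<in> cuts S le"
  shows "triangle \<alpha> \<beta> (\<alpha> \<inter> \<beta>)"
proof -
  have S: "\<alpha> \<subseteq> S" "\<beta> \<subseteq> S" using assms cut_subset by auto
  have "subadditive \<alpha> \<beta> \<alpha>" "subadditive \<alpha> \<beta> \<beta>"
    using assms S by (auto intro: subadditive_left subadditive_right)
  then have "subadditive \<alpha> \<beta> (\<alpha> \<inter> \<beta>)" unfolding subadditive_def by blast
  moreover have "subadditive \<alpha> (\<alpha> \<inter> \<beta>) \<beta>" "subadditive \<beta> (\<alpha> \<inter> \<beta>) \<alpha>"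
    using assms S by (auto intro: subadditive_right)
  ultimately show ?thesis
    using assms cuts_Int unfolding triangle_def by blast
qed

text \<open>Shrinking \<alpha> and \<beta> as sets leaves fewer premises in the condition on
  \<gamma>, while intersecting with \<open>\<alpha>' \<inter> \<beta>'\<close> makes the third side
  long enough for the other two conditions.\<close>

lemma triangle_enlarge:
  assumes "triangle \<alpha> \<beta> \<gamma>" "\<alpha>' \<in> cuts S le" "\<beta>' \<in> cuts S le" "\<alpha>' \<subseteq> \<alpha>" "\<beta>' \<subseteq> \<beta>"
  shows "triangle \<alpha>' \<beta>' (\<gamma> \<inter> (\<alpha>' \<inter> \<beta>'))"
proof -
  have max: "triangle \<alpha>' \<beta>' (\<alpha>' \<inter> \<beta>')" using assms triangle_max by blast
  have "\<gamma> \<inter> (\<alpha>' \<inter> \<beta>') \<in> cuts S le"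
    using assms(1) max cuts_Int unfolding triangle_def by blast
  moreover have "subadditive \<alpha>' \<beta>' \<gamma>"
    using assms unfolding triangle_def subadditive_def by blast
  ultimately show ?thesis
    using max unfolding triangle_def subadditive_def by blast
qed

text \<open>With \<open>zero\<close> as one summand, \<open>in_bounds_zero\<close> turns two of the
  conditions into the two inclusions.\<close>

lemma triangle_zero:
  assumes "triangle \<alpha> S \<gamma>"
  shows "\<gamma> = \<alpha>"
proof -
  have sub: "\<delta> \<subseteq> \<epsilon>" if "subadditive S \<delta> \<epsilon>" "\<delta> \<in> cuts S le" for \<delta> \<epsilon>
    using that in_bounds_zero zero_in_S cut_subset unfolding subadditive_def by blast
  have "subadditive S \<alpha> \<gamma>" "subadditive S \<gamma> \<alpha>"
    using assms subadditive_commute unfolding triangle_def by blast+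
  then show ?thesis
    using sub assms unfolding triangle_def by blast
qed

section \<open>Satisfaction of the types and of the axioms\<close>

lemma cut_le_cut_of_iff:
  assumes "\<alpha> \<in> cuts S le" "s \<in> S"
  shows "cut_le \<alpha> (cut_of S le s) \<longleftrightarrow> s \<in> \<alpha>"
  using assms le_refl S_in_R cut_upward[OF assms(1)] unfolding cut_le_def cut_of_def by blast

lemma cut_of_less_iff:
  assumes "\<alpha> \<in> cuts S le" "s \<in> S"
  shows "lt_of cut_le (cut_of S le s) \<alpha> \<longleftrightarrow> s \<notin> \<alpha>"
proof
  assume "s \<notin> \<alpha>"
  \<comment> \<open>By totality, an element of \<alpha> not above \<open>s\<close> would lie below
    \<open>s\<close> and force \<open>s\<close> into \<alpha>.\<close>
  then have "\<alpha> \<subseteq> cut_of S le s"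
    using cutsD[OF assms(1)] le_total assms(2) S_in_R unfolding cut_of_def by blast
  moreover have "s \<in> cut_of S le s" using assms le_refl S_in_R unfolding cut_of_def by blast
  ultimately show "lt_of cut_le (cut_of S le s) \<alpha>"
    using \<open>s \<notin> \<alpha>\<close> unfolding lt_of_def cut_le_def by blast
next
  assume "lt_of cut_le (cut_of S le s) \<alpha>"
  then show "s \<notin> \<alpha>"
    using cut_le_cut_of_iff[OF assms] unfolding lt_of_def cut_le_def by blast
qed

lemma sat_cut_type:
  assumes "\<alpha> \<in> cuts S le"
  shows "(\<forall>\<phi>\<in>cut_type S le \<alpha> i j. sat M I v \<phi>) \<longleftrightarrow> (\<forall>s\<in>S. I s (v i) (v j) \<longleftrightarrow> s \<in> \<alpha>)"
proof -
  have "cut_type S le \<alpha> i j = {DistLe s i j | s. s \<in> S \<and> s \<in> \<alpha>} \<union> {DistGt s i j | s. s \<in> S \<and> s \<notin> \<alpha>}"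
    using cut_le_cut_of_iff[OF assms] cut_of_less_iff[OF assms] unfolding cut_type_def by blast
  then show ?thesis by (auto simp: ball_Un)
qed

text \<open>The axioms are sentences, so the valuation \<open>v\<close> drops out on the right-hand
  side.\<close>

lemma sat_T_MS:
  "(\<forall>\<phi>\<in>T_MS S oplus le zero. sat M I v \<phi>) \<longleftrightarrow>
     (\<forall>a\<in>M. \<forall>b\<in>M. I zero a b \<longleftrightarrow> a = b) \<and>
     (\<forall>s\<in>S. \<forall>a\<in>M. \<forall>b\<in>M. I s a b \<longleftrightarrow> I s b a) \<and>
     (\<forall>r\<in>S. \<forall>s\<in>S. \<forall>t\<in>bounds r s. \<forall>a\<in>M. \<forall>b\<in>M. \<forall>c\<in>M. I r a b \<and> I s b c \<longrightarrow> I t a c) \<and>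
     (\<forall>s. is_max S le s \<longrightarrow> (\<forall>a\<in>M. \<forall>b\<in>M. I s a b))"
  (is "_ \<longleftrightarrow> ?zero \<and> ?sym \<and> ?tri \<and> ?max")
proof -
  have T_MS: "(\<forall>\<phi>\<in>T_MS S oplus le zero. P \<phi>) \<longleftrightarrow>
      P (All 0 (All 1 (Iff (DistLe zero 0 1) (Equal 0 1)))) \<and>
      (\<forall>s\<in>S. P (All 0 (All 1 (Iff (DistLe s 0 1) (DistLe s 1 0))))) \<and>
      (\<forall>r\<in>S. \<forall>s\<in>S. \<forall>t\<in>bounds r s.
        P (All 0 (All 1 (All 2 (Imp (Conj (DistLe r 0 1) (DistLe s 1 2)) (DistLe t 0 2)))))) \<and>
      (\<forall>s. is_max S le s \<longrightarrow> P (All 0 (All 1 (DistLe s 0 1))))" for P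
    unfolding T_MS_def bounds_def by blast
  have "sat M I v (All 0 (All 1 (Iff (DistLe zero 0 1) (Equal 0 1)))) \<longleftrightarrow> ?zero"
    by (simp add: iff_conv_conj_imp)
  moreover have "(\<forall>s\<in>S. sat M I v (All 0 (All 1 (Iff (DistLe s 0 1) (DistLe s 1 0))))) \<longleftrightarrow> ?sym"
    by (simp add: iff_conv_conj_imp)
  moreover have "(\<forall>r\<in>S. \<forall>s\<in>S. \<forall>t\<in>bounds r s.
      sat M I v (All 0 (All 1 (All 2 (Imp (Conj (DistLe r 0 1) (DistLe s 1 2)) (DistLe t 0 2)))))) \<longleftrightarrow> ?tri"
    by simp
  moreover have "(\<forall>s. is_max S le s \<longrightarrow> sat M I v (All 0 (All 1 (DistLe s 0 1)))) \<longleftrightarrow> ?max"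
    by simp
  ultimately show ?thesis unfolding T_MS by (simp only:)
qed

section \<open>Logical triangles and combinatorial triangles agree\<close>

lemma triangle_if_logical:
  assumes "logical_triangle S oplus le zero \<alpha> \<beta> \<gamma>"
  shows "triangle \<alpha> \<beta> \<gamma>"
proof -
  have cuts: "\<alpha> \<in> cuts S le" "\<beta> \<in> cuts S le" "\<gamma> \<in> cuts S le"
    using assms unfolding logical_triangle_def by auto
  obtain M :: "('a + nat) set" and I v where M: "range v \<subseteq> M"
    and T: "\<forall>\<phi>\<in>T_MS S oplus le zero. sat M I v \<phi>"
    and types: "\<forall>\<phi>\<in>cut_type S le \<alpha> 0 1. sat M I v \<phi>" "\<forall>\<phi>\<in>cut_type S le \<beta> 1 2. sat M I v \<phi>"
      "\<forall>\<phi>\<in>cut_type S le \<gamma> 0 2. sat M I v \<phi>"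
    using assms unfolding logical_triangle_def consistent_def by (auto simp: ball_Un)
  have I: "\<forall>s\<in>S. I s (v 0) (v 1) \<longleftrightarrow> s \<in> \<alpha>" "\<forall>s\<in>S. I s (v 1) (v 2) \<longleftrightarrow> s \<in> \<beta>"
      "\<forall>s\<in>S. I s (v 0) (v 2) \<longleftrightarrow> s \<in> \<gamma>"
    using types by (simp_all only: sat_cut_type[OF cuts(1)] sat_cut_type[OF cuts(2)]
      sat_cut_type[OF cuts(3)])
  have v: "v i \<in> M" for i using M by blast
  have sym: "I s (v i) (v j) \<longleftrightarrow> I s (v j) (v i)" if "s \<in> S" for s i j
    using conjunct1[OF conjunct2[OF T[unfolded sat_T_MS]]] that v by blast
  have tri: "I t (v i) (v k)"
    if "r \<in> S" "s \<in> S" "t \<in> bounds r s" "I r (v i) (v j)" "I s (v j) (v k)" for r s t i j k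
    using conjunct1[OF conjunct2[OF conjunct2[OF T[unfolded sat_T_MS]]]] that v by blast
  have sub: "subadditive \<delta> \<epsilon> \<zeta>"
    if "\<delta> \<in> cuts S le" "\<epsilon> \<in> cuts S le"
      and "\<forall>s\<in>S. I s (v i) (v j) \<longleftrightarrow> s \<in> \<delta>" "\<forall>s\<in>S. I s (v j) (v k) \<longleftrightarrow> s \<in> \<epsilon>"
      "\<forall>s\<in>S. I s (v i) (v k) \<longleftrightarrow> s \<in> \<zeta>" for \<delta> \<epsilon> \<zeta> i j k
    unfolding subadditive_def
  proof (intro ballI subsetI)
    fix r s t assume rst: "r \<in> \<delta>" "s \<in> \<epsilon>" "t \<in> bounds r s"
    then have "r \<in> S" "s \<in> S" "t \<in> S"
      using that cut_subset unfolding bounds_def by blast+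
    then show "t \<in> \<zeta>" using rst that tri by blast
  qed
  \<comment> \<open>Each of the three points serves once as the middle point \<open>j\<close>;
    symmetry (MS2) reverses the sides where needed.\<close>
  have "subadditive \<alpha> \<beta> \<gamma>" by (rule sub[of _ _ 0 1 2]) (use cuts I in blast)+
  moreover have "subadditive \<alpha> \<gamma> \<beta>" by (rule sub[of _ _ 1 0 2]) (use cuts I sym in blast)+
  moreover have "subadditive \<gamma> \<beta> \<alpha>" by (rule sub[of _ _ 0 2 1]) (use cuts I sym in blast)+
  ultimately show ?thesis
    using cuts subadditive_commute unfolding triangle_def by blast
qed

text \<open>Points at distance \<open>0\<close> have to be identified because of (MS1); each one is represented by the
  least index of its class.\<close>

lemma sat_T_MS_if_metric:
  fixes D :: "nat \<Rightarrow> nat \<Rightarrow> 'a set"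
  assumes cuts: "\<And>i j. D i j \<in> cuts S le"
    and diag: "\<And>i. D i i = S"
    and sym: "\<And>i j. D i j = D j i"
    and sub: "\<And>i j k. subadditive (D i j) (D j k) (D i k)"
  obtains I and v :: "nat \<Rightarrow> 'a + nat"
  where "\<forall>\<phi>\<in>T_MS S oplus le zero. sat (range v) I v \<phi>"
    and "\<And>s i j. I s (v i) (v j) \<longleftrightarrow> s \<in> D i j"
proof -
  define v :: "nat \<Rightarrow> 'a + nat" where "v i = Inr (LEAST j. D i j = S)" for i
  \<comment> \<open>The relation is defined through arbitrary indices of the two points; its
    independence of that choice is the fact \<open>I\<close> below.\<close>
  define I where "I s a b \<longleftrightarrow> (\<exists>i j. a = v i \<and> b = v j \<and> s \<in> D i j)" for s a b
  \<comment> \<open>The summand \<open>zero\<close> lies in \<open>D i j = S\<close>, so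
    \<open>in_bounds_zero\<close> applies.\<close>
  have le: "D j k \<subseteq> D i k" if "D i j = S" for i j k
    using that sub[of i j k] in_bounds_zero zero_in_S cut_subset[OF cuts]
    unfolding subadditive_def by blast
  have eq: "D i k = D j k" if "D i j = S" for i j k
    using le[of i j k] le[of j i k] that sym[of i j] by blast
  have v_eq: "v i = v j \<longleftrightarrow> D i j = S" for i j
  proof
    let ?m = "\<lambda>k. LEAST j. D k j = S"
    assume "v i = v j"
    then have "?m i = ?m j" unfolding v_def by simp
    moreover have rep: "D k (?m k) = S" for k
      using diag by (rule LeastI)
    ultimately have "D i (?m j) = S" using rep[of i] by simp
    then show "D i j = S"
      using eq[OF rep[of j], of i] sym[of i j] sym[of i "?m j"] by simp
  next
    assume "D i j = S"
    then show "v i = v j" unfolding v_def by (simp add: eq[of i j])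
  qed
  have I: "I s (v i) (v j) \<longleftrightarrow> s \<in> D i j" for s i j
  proof
    assume "I s (v i) (v j)"
    then obtain i' j' where "D i i' = S" "D j j' = S" "s \<in> D i' j'"
      unfolding I_def v_eq by blast
    then show "s \<in> D i j"
      using eq[of i i' j] eq[of j j' i'] sym[of j i'] sym[of j' i'] by simp
  next
    assume "s \<in> D i j"
    then show "I s (v i) (v j)" unfolding I_def by blast
  qed
  \<comment> \<open>Together with \<open>v_eq\<close> this is (MS1): a cut containing the least
    element is all of \<open>S\<close>.\<close>
  have zero: "zero \<in> D i j \<longleftrightarrow> D i j = S" for i j
    using cut_eq_S[OF cuts] zero_in_S by auto
  have "\<forall>\<phi>\<in>T_MS S oplus le zero. sat (range v) I v \<phi>"
    unfolding sat_T_MS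
  proof (intro conjI)
    show "\<forall>a\<in>range v. \<forall>b\<in>range v. I zero a b \<longleftrightarrow> a = b"
      by (auto simp: I v_eq zero)
    show "\<forall>s\<in>S. \<forall>a\<in>range v. \<forall>b\<in>range v. I s a b \<longleftrightarrow> I s b a"
      using sym by (auto simp: I)
    show "\<forall>r\<in>S. \<forall>s\<in>S. \<forall>t\<in>bounds r s. \<forall>a\<in>range v. \<forall>b\<in>range v. \<forall>c\<in>range v.
      I r a b \<and> I s b c \<longrightarrow> I t a c"
      using sub unfolding subadditive_def by (simp add: I) blast
    show "\<forall>s. is_max S le s \<longrightarrow> (\<forall>a\<in>range v. \<forall>b\<in>range v. I s a b)"
      using cut_max[OF cuts] by (auto simp: I)
  qed
  with I that show thesis by blast
qed

lemma logical_if_triangle: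
  assumes tri: "triangle \<alpha> \<beta> \<gamma>"
  shows "logical_triangle S oplus le zero \<alpha> \<beta> \<gamma>"
proof -
  have cuts: "\<alpha> \<in> cuts S le" "\<beta> \<in> cuts S le" "\<gamma> \<in> cuts S le"
    using tri unfolding triangle_def by auto
  \<comment> \<open>Index sums 1, 3 and 2 single out the pairs {0, 1}, {1, 2} and {0, 2}. As a
    valuation assigns a point to every natural number, \<open>D\<close> sends all indices above 2 to
    the third point.\<close>
  define E where "E i j = (if i = j then S else if i + j = 1 then \<alpha>
    else if i + j = 3 then \<beta> else \<gamma>)" for i j :: nat
  define D where "D i j = E (min i 2) (min j 2)" for i j
  have E_cuts: "E i j \<in> cuts S le" for i j
    unfolding E_def using cuts S_in_cuts by simp
  have E_sym: "E i j = E j i" for i j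
    unfolding E_def by (simp add: add.commute)
  \<comment> \<open>When two of the three indices coincide, one side is \<open>S\<close> (distance
    0) and the other two are equal.\<close>
  have degenerate: "subadditive S \<delta> \<delta>" "subadditive \<delta> S \<delta>" "subadditive \<delta> \<delta> S"
    if "\<delta> \<in> cuts S le" for \<delta>
    using that S_in_cuts cut_subset by (auto intro: subadditive_left subadditive_right)
  have six: "subadditive \<alpha> \<beta> \<gamma>" "subadditive \<alpha> \<gamma> \<beta>" "subadditive \<beta> \<gamma> \<alpha>"
    "subadditive \<beta> \<alpha> \<gamma>" "subadditive \<gamma> \<alpha> \<beta>" "subadditive \<gamma> \<beta> \<alpha>"
    using tri subadditive_commute unfolding triangle_def by blast+
  have E_sub: "\<forall>i\<in>{0, 1, 2}. \<forall>j\<in>{0, 1, 2}. \<forall>k\<in>{0, 1, 2}. subadditive (E i j) (E j k) (E i k)"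
    by (simp add: E_def six degenerate cuts S_in_cuts)
  have "min i 2 \<in> {0, 1, 2}" for i :: nat by auto
  then have "subadditive (D i j) (D j k) (D i k)" for i j k
    unfolding D_def using E_sub by blast
  moreover have "D i i = S" for i unfolding D_def E_def by simp
  moreover have "D i j \<in> cuts S le" "D i j = D j i" for i j
    unfolding D_def by (rule E_cuts, rule E_sym)
  ultimately obtain I and v :: "nat \<Rightarrow> 'a + nat"
    where T: "\<forall>\<phi>\<in>T_MS S oplus le zero. sat (range v) I v \<phi>"
      and I: "\<And>s i j. I s (v i) (v j) \<longleftrightarrow> s \<in> D i j"
    using sat_T_MS_if_metric[of D] by metis
  have "D 0 1 = \<alpha>" "D 1 2 = \<beta>" "D 0 2 = \<gamma>" unfolding D_def E_def by simp_all
  then have "\<forall>\<phi>\<in>cut_type S le \<alpha> 0 1. sat (range v) I v \<phi>"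
    "\<forall>\<phi>\<in>cut_type S le \<beta> 1 2. sat (range v) I v \<phi>"
    "\<forall>\<phi>\<in>cut_type S le \<gamma> 0 2. sat (range v) I v \<phi>"
    using I by (simp_all add: sat_cut_type cuts)
  then show ?thesis
    using T cuts unfolding logical_triangle_def consistent_def ball_Un
    by (intro conjI exI[of _ "range v"] exI[of _ I] exI[of _ v]) auto
qed

section \<open>The sum of cuts and the magma axioms\<close>

text \<open>If \<alpha> or \<beta> is not a cut, there are no triangles and both sides are
  \<open>S\<close>.\<close>

lemma cut_plus_eq: "cut_plus S oplus le zero \<alpha> \<beta> = S \<inter> \<Inter>{\<gamma>. triangle \<alpha> \<beta> \<gamma>}"
proof -
  have "logical_triangle S oplus le zero \<alpha> \<beta> = triangle \<alpha> \<beta>"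
    by (rule ext, rule iffI, erule triangle_if_logical, erule logical_if_triangle)
  moreover have "{\<gamma>. triangle \<alpha> \<beta> \<gamma>} \<subseteq> cuts S le"
    unfolding triangle_def by blast
  ultimately show ?thesis
    unfolding cut_plus_def by (simp add: cut_sup_eq)
qed

lemma cut_plus_commute: "cut_plus S oplus le zero \<alpha> \<beta> = cut_plus S oplus le zero \<beta> \<alpha>"
proof -
  have "triangle \<alpha> \<beta> \<gamma> \<longleftrightarrow> triangle \<beta> \<alpha> \<gamma>" for \<gamma>
    by (rule iffI; erule triangle_commute)
  then have "{\<gamma>. triangle \<alpha> \<beta> \<gamma>} = {\<gamma>. triangle \<beta> \<alpha> \<gamma>}"
    by (rule Collect_cong)
  then show ?thesis unfolding cut_plus_eq by (rule arg_cong)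
qed

text \<open>The set of third sides is the singleton of \<alpha>: \<open>triangle_max\<close> gives
  existence because \<open>\<alpha> \<inter> S = \<alpha>\<close>, and \<open>triangle_zero\<close>
  gives uniqueness.\<close>

lemma cut_plus_zero:
  assumes "\<alpha> \<in> cuts S le"
  shows "cut_plus S oplus le zero \<alpha> S = \<alpha>"
proof -
  have "triangle \<alpha> S \<gamma> \<longleftrightarrow> \<gamma> = \<alpha>" for \<gamma>
  proof
    assume "\<gamma> = \<alpha>"
    then show "triangle \<alpha> S \<gamma>"
      using triangle_max[OF assms S_in_cuts] cut_subset[OF assms] by (simp add: Int_absorb2)
  qed (rule triangle_zero)
  then show ?thesis
    unfolding cut_plus_eq using cut_subset[OF assms] by auto
qed

lemma distance_magma_cuts:
  "distance_magma (cuts S le) (cut_plus S oplus le zero) cut_le (cut_of S le zero)"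
proof
  fix \<alpha> \<beta> \<alpha>' \<beta>'
  assume \<alpha>: "\<alpha> \<in> cuts S le"
  show "cut_plus S oplus le zero \<alpha> (cut_of S le zero) = \<alpha>"
    "cut_plus S oplus le zero (cut_of S le zero) \<alpha> = \<alpha>"
    using cut_plus_zero[OF \<alpha>] cut_plus_commute[of S \<alpha>] by (simp_all add: cut_of_zero)
  assume \<beta>: "\<beta> \<in> cuts S le"
  show "cut_plus S oplus le zero \<alpha> \<beta> \<in> cuts S le"
    unfolding cut_plus_eq by (rule cuts_Inter) (auto simp: triangle_def)
  show "cut_plus S oplus le zero \<alpha> \<beta> = cut_plus S oplus le zero \<beta> \<alpha>"
    by (rule cut_plus_commute)
  show "cut_le \<alpha> (cut_plus S oplus le zero \<alpha> \<beta>)"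
    unfolding cut_le_def cut_plus_eq using triangle_max[OF \<alpha> \<beta>] by blast
  assume "\<alpha>' \<in> cuts S le" "\<beta>' \<in> cuts S le" "cut_le \<alpha> \<alpha>'" "cut_le \<beta> \<beta>'"
  \<comment> \<open>Every third side \<gamma> for \<alpha>, \<beta> thus contains a third side for
    \<open>\<alpha>'\<close>, \<open>\<beta>'\<close>, which yields the inclusion of the
    intersections.\<close>
  then have "triangle \<alpha>' \<beta>' (\<gamma> \<inter> (\<alpha>' \<inter> \<beta>'))" if "triangle \<alpha> \<beta> \<gamma>" for \<gamma>
    using that triangle_enlarge unfolding cut_le_def by simp
  then show "cut_le (cut_plus S oplus le zero \<alpha> \<beta>) (cut_plus S oplus le zero \<alpha>' \<beta>')"
    unfolding cut_le_def cut_plus_eq by blast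
next
  show "cut_of S le zero \<in> cuts S le" using cut_of_zero S_in_cuts by simp
  show "linear_order_on (cuts S le) {(x, y). x \<in> cuts S le \<and> y \<in> cuts S le \<and> cut_le x y}"
    by (rule cuts_linear_order)
qed

end

theorem theorem2p13:
  fixes R S :: "'a set"
    and oplus :: "'a \<Rightarrow> 'a \<Rightarrow> 'a"
    and le :: "'a \<Rightarrow> 'a \<Rightarrow> bool"
    and zero :: 'a
  assumes "distance_magma R oplus le zero"
    and "S \<subseteq> R"
    and "zero \<in> S"
  shows "distance_magma (cuts S le) (cut_plus S oplus le zero) cut_le (cut_of S le zero)"
proof -
  interpret distance_submagma R oplus le zero S
    using assms by (intro distance_submagma.intro distance_submagma_axioms.intro)
  show ?thesis by (rule distance_magma_cuts)
qed

end
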